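(* Let $M$ be a matroid on a finite set $V$ of vertices with rank function $\rho$, and let $K \subset \mathbb{R}^d$ be an open set of volume one. For each $v \in V$ let $F_v$ be an open convex set in $\mathbb{R}^d$. Suppose that for each set $V' \subset V$ that is independent in $M$ there exist $a \in \mathbb{R}^d$ and $A \in \mathcal{P}_d$ with $\det A = 1$ and $a + AK \subset \bigcap_{v \in V'} F_v$. Then there exists a set $\tau \subset V$ such that $\rho(V \setminus \tau) \le d(d+3)/2 - 1$ and there exist $a \in \mathbb{R}^d$ and $A \in \mathcal{P}_d$ with $\det A = 1$ and $a + AK \subset \bigcap_{v \in \tau} F_v$.
   Context: $\mathcal{P}_d$ denotes the set of symmetric positive definite $d \times d$ real matrices, and $a + AK = \{a + Ax : x \in K\}$. A matroid $M$ on a finite set $V$ is a family of subsets of $V$ (independent sets) with $\emptyset \in M$; closed under taking subsets; and if $A, B \in M$ with $|B| > |A|$ there is $a \in B \setminus A$ with $A \cup \{a\} \in M$. The rank $\rho(V')$ is the size of the largest independent subset of $V'$. An intersection over the empty index set is $\mathbb{R}^d$. *)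

theory Defs
  imports "HOL-Analysis.Analysis"
begin

definition matroid :: "'v set \<Rightarrow> 'v set set \<Rightarrow> bool" where
  "matroid V M \<longleftrightarrow>
     finite V \<and> M \<subseteq> Pow V \<and> {} \<in> M \<and>
     (\<forall>A B. A \<in> M \<and> B \<subseteq> A \<longrightarrow> B \<in> M) \<and>
     (\<forall>A B. A \<in> M \<and> B \<in> M \<and> card A < card B \<longrightarrow> (\<exists>a\<in>B - A. insert a A \<in> M))"

definition matroid_rank :: "'v set set \<Rightarrow> 'v set \<Rightarrow> nat" where
  "matroid_rank M W = Max {card I | I. I \<in> M \<and> I \<subseteq> W}"

definition pos_def_matrices :: "(real ^ 'n ^ 'n) set" where
  "pos_def_matrices = {A. transpose A = A \<and> (\<forall>x. x \<noteq> 0 \<longrightarrow> x \<bullet> (A *v x) > 0)}"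

definition affine_copy :: "real ^ 'n \<Rightarrow> real ^ 'n ^ 'n \<Rightarrow> (real ^ 'n) set \<Rightarrow> (real ^ 'n) set" where
  "affine_copy a A K = {a + A *v x | x. x \<in> K}"

end

theory Submission
  imports Defs
begin

text \<open>
  A copy of \<open>K\<close> is a point \<open>(a, A)\<close> of the space of vectors and symmetric matrices, whose dimension is
  \<open>N = d (d + 3) / 2\<close>; the copies inside a convex set form a convex set \<open>C v\<close>, and so do the positive
  definite matrices with \<open>det A \<ge> c\<close>. Fix \<open>c < 1\<close> and, for each independent set, minimise the norm of
  \<open>(a, A)\<close> over the copies with \<open>det A \<ge> c\<close>; let \<open>p\<close> be the minimiser for the independent set \<open>I\<close> with the
  largest minimum. Shrinking \<open>A\<close> decreases the norm, so the sets \<open>C v\<close> for \<open>v \<in> I\<close>, \<open>{det A > c}\<close> and the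
  ball of radius \<open>norm p\<close> have no common point. In Helly's theorem two of the \<open>N + 1\<close> sets have to be the
  last two, hence already some \<open>\<sigma> \<subseteq> I\<close> of size at most \<open>N - 1\<close> has \<open>p\<close> as its unique minimiser.
  If \<open>p \<notin> C v\<close>, adding \<open>v\<close> to \<open>\<sigma>\<close> would increase the minimum, so \<open>insert v \<sigma>\<close> is dependent; thus the \<open>v\<close> with
  \<open>p \<notin> C v\<close> have rank at most \<open>N - 1\<close>. The slack \<open>c < 1\<close> is removed by compactness.
\<close>

subsection \<open>Helly's theorem and norm minimisation over a matroid\<close>

text \<open>Induction on \<open>card I\<close>: leaving out one index at a time gives points
  \<open>x i\<close>, and a Radon partition of them yields a common point. The family is indexed, so
  repeated sets count separately, and \<open>dim S\<close> replaces the dimension of the ambient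
  type.\<close>

lemma Helly_subspace:
  fixes C :: "'i \<Rightarrow> 'a::euclidean_space set"
  assumes "finite I"
    and "\<And>i. i \<in> I \<Longrightarrow> convex (C i)"
    and "\<And>J. J \<subseteq> I \<Longrightarrow> card J \<le> dim S + 1 \<Longrightarrow> S \<inter> (\<Inter>i\<in>J. C i) \<noteq> {}"
    and "subspace S"
  shows "S \<inter> (\<Inter>i\<in>I. C i) \<noteq> {}"
  using assms(1-3)
proof (induction "card I" arbitrary: I)
  case 0
  then show ?case by (metis card.empty finite.emptyI subset_refl zero_le)
next
  case (Suc n)
  show ?case
  proof (cases "card I \<le> dim S + 1")
    case True
    then show ?thesis using Suc.prems(3) by blast
  next
    case False
    have "\<exists>x. x \<in> S \<inter> (\<Inter>j\<in>I - {i}. C j)" if "i \<in> I" for i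
    proof -
      have "S \<inter> (\<Inter>j\<in>I - {i}. C j) \<noteq> {}"
      proof (rule Suc.hyps(1))
        show "n = card (I - {i})" using Suc.hyps(2) that Suc.prems(1) by simp
        show "S \<inter> (\<Inter>j\<in>J. C j) \<noteq> {}" if "J \<subseteq> I - {i}" "card J \<le> dim S + 1" for J
          using Suc.prems(3) that by blast
      qed (use Suc.prems in auto)
      then show ?thesis by blast
    qed
    then obtain x where x: "\<And>i. i \<in> I \<Longrightarrow> x i \<in> S"
      "\<And>i j. i \<in> I \<Longrightarrow> j \<in> I \<Longrightarrow> i \<noteq> j \<Longrightarrow> x i \<in> C j"
      by (metis (no_types, lifting) DiffI INT_E IntE singletonD)
    show ?thesis
    proof (cases "inj_on x I")
      case False
      \<comment> \<open>A repeated point lies in every \<open>C k\<close>, because \<open>k\<close>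
        differs from \<open>i\<close> or from \<open>j\<close>.\<close>
      then obtain i j where ij: "i \<in> I" "j \<in> I" "i \<noteq> j" "x i = x j"
        by (auto simp: inj_on_def)
      then have "x i \<in> C k" if "k \<in> I" for k
        using x(2) that by (cases "k = i") metis+
      then show ?thesis using x(1) ij(1) by blast
    next
      case True
      have "dim (x ` I) \<le> dim S"
        using x(1) by (intro dim_subset) auto
      then have "affine_dependent (x ` I)"
        using False Suc.prems(1) card_image[OF True]
        by (intro affine_dependent_biggerset_general) auto
      then obtain P Q where PQ: "P \<inter> Q = {}" "P \<union> Q = x ` I"
          "convex hull P \<inter> convex hull Q \<noteq> {}"
        using Radon_partition[of "x ` I"] Suc.prems(1) by auto
      then obtain z where z: "z \<in> convex hull P" "z \<in> convex hull Q" by blast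
      have "z \<in> C i" if "i \<in> I" for i
      proof -
        \<comment> \<open>Only the point \<open>x i\<close> can fail to lie in \<open>C i\<close>,
          so the side of the partition without it is contained in \<open>C i\<close>, and so is its
          hull.\<close>
        have "P \<subseteq> C i \<or> Q \<subseteq> C i"
        proof (cases "x i \<in> P")
          case True
          have "y \<in> C i" if "y \<in> Q" for y
          proof -
            obtain j where j: "j \<in> I" "y = x j" using PQ(2) \<open>y \<in> Q\<close> by blast
            then have "j \<noteq> i" using PQ(1) \<open>y \<in> Q\<close> True by auto
            then show ?thesis using x(2) j \<open>i \<in> I\<close> by auto
          qed
          then have "Q \<subseteq> C i" by blast
          then show ?thesis ..
        next
          case False
          then have "y \<in> C i" if "y \<in> P" for y
            using x(2) PQ(2) that \<open>i \<in> I\<close> by (metis UnI1 imageE)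
          then have "P \<subseteq> C i" by blast
          then show ?thesis ..
        qed
        then show ?thesis
          using z hull_minimal[of P "C i" convex] hull_minimal[of Q "C i" convex] Suc.prems(2)[OF that]
          by blast
      qed
      moreover have "z \<in> S"
      proof -
        have "x ` I \<subseteq> S" using x(1) by (rule image_subsetI)
        then have "P \<subseteq> S" unfolding PQ(2)[symmetric] by simp
        then show ?thesis
          using z(1) hull_minimal[of P S convex] subspace_imp_convex[OF assms(4)] by (simp add: subset_iff)
      qed
      ultimately have "z \<in> S \<inter> (\<Inter>i\<in>I. C i)" by simp
      then show ?thesis by (metis empty_iff)
    qed
  qed
qed

text \<open>A larger independent subset of \<open>W\<close> would, by exchange, supply an element of
  \<open>W\<close> that extends \<open>\<sigma>\<close>.\<close>

lemma matroid_rank_le: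
  assumes "matroid V M" "\<sigma> \<in> M" "\<And>v. v \<in> W \<Longrightarrow> v \<notin> \<sigma> \<Longrightarrow> insert v \<sigma> \<notin> M"
  shows "matroid_rank M W \<le> card \<sigma>"
proof -
  have "finite M" using assms(1) unfolding matroid_def by (meson finite_Pow_iff finite_subset)
  have "{} \<in> M" using assms(1) unfolding matroid_def by blast
  have "card J \<le> card \<sigma>" if "J \<in> M" "J \<subseteq> W" for J
  proof (rule ccontr)
    assume "\<not> card J \<le> card \<sigma>"
    then obtain a where "a \<in> J - \<sigma>" "insert a \<sigma> \<in> M"
      using assms(1,2) \<open>J \<in> M\<close> unfolding matroid_def by (meson not_le)
    then show False using assms(3) that(2) by blast
  qed
  moreover have "finite {card I |I. I \<in> M \<and> I \<subseteq> W}" using \<open>finite M\<close> by simp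
  moreover have "{card I |I. I \<in> M \<and> I \<subseteq> W} \<noteq> {}" using \<open>{} \<in> M\<close> by blast
  ultimately show ?thesis
    unfolding matroid_rank_def by (subst Max_le_iff) auto
qed

text \<open>\<open>G'\<close> is the strict version of \<open>G\<close>. By \<open>shrink\<close>,
  the sets \<open>C v\<close>, \<open>G'\<close> and the ball of radius \<open>norm p\<close> have
  no common point; Helly then finds a small \<open>\<sigma>\<close> for which this already fails,
  and \<open>toG'\<close> carries the conclusion from \<open>G'\<close> back to
  \<open>G\<close>.\<close>

lemma basis_of_norm_minimum:
  fixes C :: "'v \<Rightarrow> 'a::euclidean_space set"
  assumes "finite I" and conv: "\<And>v. v \<in> I \<Longrightarrow> convex (C v)"
    and S: "subspace S" "dim S \<le> N"
    and G: "G \<subseteq> S" "G' \<subseteq> G" "convex G'"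
    and toG': "\<And>q r s. q \<in> G \<Longrightarrow> r \<in> G' \<Longrightarrow> 0 < s \<Longrightarrow> s \<le> 1 \<Longrightarrow> (1 - s) *\<^sub>R q + s *\<^sub>R r \<in> G'"
    and shrink: "\<And>q. q \<in> G' \<Longrightarrow> (\<And>v. v \<in> I \<Longrightarrow> q \<in> C v) \<Longrightarrow>
           \<exists>q'\<in>G. (\<forall>v\<in>I. q' \<in> C v) \<and> norm q' < norm q"
    and slack: "G' \<inter> (\<Inter>v\<in>I. C v) \<noteq> {}"
    and p: "p \<in> G \<inter> (\<Inter>v\<in>I. C v)"
    and pmin: "\<And>q. q \<in> G \<inter> (\<Inter>v\<in>I. C v) \<Longrightarrow> norm p \<le> norm q"
  shows "\<exists>\<sigma>\<subseteq>I. card \<sigma> + 1 \<le> N \<and> (\<forall>q \<in> G \<inter> (\<Inter>v\<in>\<sigma>. C v). norm p \<le> norm q)"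
proof -
  obtain r where r: "r \<in> G'" "\<And>v. v \<in> I \<Longrightarrow> r \<in> C v" using slack by blast
  have "\<exists>\<sigma>\<subseteq>I. card \<sigma> + 1 \<le> N \<and> G' \<inter> (\<Inter>v\<in>\<sigma>. C v) \<inter> cball 0 (norm p) = {}"
  proof (rule ccontr)
    assume "\<not> ?thesis"
    then have meet: "\<And>\<sigma>. \<sigma> \<subseteq> I \<Longrightarrow> card \<sigma> + 1 \<le> N \<Longrightarrow> \<exists>q\<in>G'. (\<forall>v\<in>\<sigma>. q \<in> C v) \<and> norm q \<le> norm p"
      by fastforce
    \<comment> \<open>The sum type keeps the indices of \<open>G'\<close> (\<open>Inr True\<close>)
      and of the ball (\<open>Inr False\<close>) apart from those of the \<open>C v\<close>.\<close>
    define D where "D = case_sum C (\<lambda>b. if b then G' else cball 0 (norm p))"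
    have D: "D (Inl v) = C v" "D (Inr True) = G'" "D (Inr False) = cball 0 (norm p)" for v
      by (simp_all add: D_def)
    have "S \<inter> (\<Inter>i\<in>Inl ` I \<union> range Inr. D i) \<noteq> {}"
    proof (rule Helly_subspace)
      show "finite (Inl ` I \<union> range Inr :: ('v + bool) set)" using \<open>finite I\<close> by simp
      show "convex (D i)" if "i \<in> Inl ` I \<union> range Inr" for i
        using that conv G(3) by (auto simp: D_def)
    next
      fix J :: "('v + bool) set" assume J: "J \<subseteq> Inl ` I \<union> range Inr" "card J \<le> dim S + 1"
      define \<sigma> where "\<sigma> = {v. Inl v \<in> J}"
      have \<sigma>: "\<sigma> \<subseteq> I" using J(1) by (auto simp: \<sigma>_def)
      have DJ: "q \<in> D i" if "i \<in> J" "\<forall>v\<in>\<sigma>. q \<in> C v" "Inr True \<in> J \<longrightarrow> q \<in> G'"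
          "Inr False \<in> J \<longrightarrow> norm q \<le> norm p" for q i
      proof (cases i)
        case (Inl v)
        then show ?thesis using that by (auto simp: D \<sigma>_def)
      next
        case (Inr b)
        then show ?thesis using that by (cases b) (auto simp: D)
      qed
      \<comment> \<open>If \<open>G'\<close> is absent, \<open>p\<close> is a common point; if the
        ball is absent, \<open>r\<close> is. If both are present they use up two of the
        \<open>dim S + 1\<close> places, which leaves at most \<open>N - 1\<close> constraints for
        \<open>meet\<close>.\<close>
      consider "Inr True \<notin> J" | "Inr False \<notin> J" | "Inr True \<in> J" "Inr False \<in> J" by blast
      then show "S \<inter> (\<Inter>i\<in>J. D i) \<noteq> {}"
      proof cases
        case 1
        then have "p \<in> D i" if "i \<in> J" for i using that p \<sigma> by (intro DJ) auto
        then show ?thesis using p G by blast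
      next
        case 2
        then have "r \<in> D i" if "i \<in> J" for i using that r \<sigma> by (intro DJ) auto
        then show ?thesis using r(1) G by blast
      next
        case 3
        have "finite J" by (rule finite_subset[OF J(1)]) (simp add: \<open>finite I\<close>)
        have "Inl ` \<sigma> \<union> {Inr True, Inr False} \<subseteq> J" using 3 by (auto simp: \<sigma>_def)
        then have "card (Inl ` \<sigma> \<union> {Inr True, Inr False} :: ('v + bool) set) \<le> card J"
          using \<open>finite J\<close> card_mono by blast
        moreover have "card (Inl ` \<sigma> \<union> {Inr True, Inr False} :: ('v + bool) set) = card \<sigma> + 2"
          using finite_subset[OF \<sigma> \<open>finite I\<close>]
          by (subst card_Un_disjoint) (auto simp: card_image)
        ultimately have "card \<sigma> + 1 \<le> N" using J(2) S(2) by linarith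
        then obtain q where "q \<in> G'" "\<forall>v\<in>\<sigma>. q \<in> C v" "norm q \<le> norm p" using meet[OF \<sigma>] by blast
        then have "q \<in> S" "\<And>i. i \<in> J \<Longrightarrow> q \<in> D i" using G DJ by blast+
        then show ?thesis by blast
      qed
    qed (rule S)
    then obtain q where q: "\<And>i. i \<in> Inl ` I \<union> range Inr \<Longrightarrow> q \<in> D i" by blast
    have "q \<in> G'" "norm q \<le> norm p" "\<And>v. v \<in> I \<Longrightarrow> q \<in> C v"
      using q[of "Inr True"] q[of "Inr False"] q[of "Inl _"] by (auto simp: D)
    then show False using shrink[of q] pmin by fastforce
  qed
  then obtain \<sigma> where \<sigma>: "\<sigma> \<subseteq> I" "card \<sigma> + 1 \<le> N" and empty: "G' \<inter> (\<Inter>v\<in>\<sigma>. C v) \<inter> cball 0 (norm p) = {}"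
    by blast
  have "norm p \<le> norm q" if q: "q \<in> G" "\<And>v. v \<in> \<sigma> \<Longrightarrow> q \<in> C v" for q
  proof (rule ccontr)
    assume less: "\<not> norm p \<le> norm q"
    \<comment> \<open>The step from \<open>q\<close> towards \<open>r\<close> is short enough to
      stay in the ball, yet positive, so that it enters \<open>G'\<close>. Adding 1 keeps the
      denominator positive when \<open>r = 0\<close>.\<close>
    define s where "s = min 1 ((norm p - norm q) / (norm r + 1))"
    have s: "0 < s" "s \<le> 1" using less by (auto simp: s_def add_nonneg_pos)
    have "0 < norm r + 1" by (simp add: add_nonneg_pos)
    moreover have "s \<le> (norm p - norm q) / (norm r + 1)" by (simp add: s_def)
    ultimately have "s * (norm r + 1) \<le> norm p - norm q" by (simp only: pos_le_divide_eq)
    moreover have "s * norm r \<le> s * (norm r + 1)" using s by (simp add: mult_left_mono)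
    moreover have "norm ((1 - s) *\<^sub>R q + s *\<^sub>R r) \<le> (1 - s) * norm q + s * norm r"
      using s by (intro norm_triangle_le) simp
    moreover have "(1 - s) * norm q \<le> 1 * norm q" using s by (intro mult_right_mono) auto
    ultimately have "norm ((1 - s) *\<^sub>R q + s *\<^sub>R r) \<le> norm p" by linarith
    moreover have "(1 - s) *\<^sub>R q + s *\<^sub>R r \<in> C v" if "v \<in> \<sigma>" for v
      using that \<sigma>(1) s by (intro convexD_alt conv q(2) r(2)) auto
    moreover have "(1 - s) *\<^sub>R q + s *\<^sub>R r \<in> G'" using toG' q(1) r(1) s by blast
    ultimately show False using empty by auto
  qed
  then show ?thesis using \<sigma> by blast
qed

lemma norm_minimizer_exists:
  fixes X :: "'a::euclidean_space set"
  assumes "closed X" "X \<noteq> {}"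
  obtains p where "p \<in> X" "\<And>q. q \<in> X \<Longrightarrow> norm p \<le> norm q"
  using distance_attains_inf[OF assms, of 0] by (auto simp: dist_norm)

text \<open>Uniqueness of the point of least norm turns the maximal choice of \<open>I\<close> into
  a rank bound. The conclusion also keeps an independent set for which \<open>p\<close> is minimal;
  comparison with any feasible point of that set then bounds \<open>norm p\<close>.\<close>

lemma matroid_norm_minimum:
  fixes C :: "'v \<Rightarrow> 'a::euclidean_space set"
  assumes mat: "matroid V M"
    and conv: "\<And>v. v \<in> V \<Longrightarrow> convex (C v)" and clos: "\<And>v. v \<in> V \<Longrightarrow> closed (C v)"
    and S: "subspace S" "dim S \<le> N"
    and G: "G \<subseteq> S" "G' \<subseteq> G" "convex G'" "convex G" "closed G"
    and toG': "\<And>q r s. q \<in> G \<Longrightarrow> r \<in> G' \<Longrightarrow> 0 < s \<Longrightarrow> s \<le> 1 \<Longrightarrow> (1 - s) *\<^sub>R q + s *\<^sub>R r \<in> G'"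
    and shrink: "\<And>I q. I \<subseteq> V \<Longrightarrow> q \<in> G' \<Longrightarrow> (\<And>v. v \<in> I \<Longrightarrow> q \<in> C v) \<Longrightarrow>
           \<exists>q'\<in>G. (\<forall>v\<in>I. q' \<in> C v) \<and> norm q' < norm q"
    and slack: "\<And>I. I \<in> M \<Longrightarrow> G' \<inter> (\<Inter>v\<in>I. C v) \<noteq> {}"
  shows "\<exists>\<tau>\<subseteq>V. matroid_rank M (V - \<tau>) + 1 \<le> N \<and>
           (\<exists>p\<in>G \<inter> (\<Inter>v\<in>\<tau>. C v). \<exists>I\<in>M. \<forall>q\<in>G \<inter> (\<Inter>v\<in>I. C v). norm p \<le> norm q)"
proof -
  have M: "finite V" "M \<subseteq> Pow V" "{} \<in> M" "\<And>A B. A \<in> M \<Longrightarrow> B \<subseteq> A \<Longrightarrow> B \<in> M"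
    using mat unfolding matroid_def by auto
  have finM: "finite M" using M by (meson finite_Pow_iff finite_subset)
  define X where "X I = G \<inter> (\<Inter>v\<in>I. C v)" for I
  have X: "closed (X I)" "convex (X I)" "X I \<noteq> {}" if "I \<in> M" for I
  proof -
    have "I \<subseteq> V" using M that by blast
    then show "closed (X I)" "convex (X I)"
      unfolding X_def using clos conv G
      by (auto intro!: closed_Int closed_INT convex_Int convex_INT)
    show "X I \<noteq> {}" using slack[OF that] G unfolding X_def by blast
  qed
  have "\<forall>I\<in>M. \<exists>p. p \<in> X I \<and> (\<forall>q\<in>X I. norm p \<le> norm q)"
    using X norm_minimizer_exists by metis
  then obtain p where p: "\<And>I. I \<in> M \<Longrightarrow> p I \<in> X I"
    "\<And>I q. I \<in> M \<Longrightarrow> q \<in> X I \<Longrightarrow> norm (p I) \<le> norm q" by metis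
  have "\<exists>I\<in>M. \<forall>J\<in>M. norm (p J) \<le> norm (p I)"
  proof -
    have fin: "finite ((\<lambda>J. norm (p J)) ` M)" and ne: "(\<lambda>J. norm (p J)) ` M \<noteq> {}"
      using finM M(3) by auto
    obtain I where "I \<in> M" "Max ((\<lambda>J. norm (p J)) ` M) = norm (p I)"
      using Max_in[OF fin ne] by auto
    then show ?thesis using Max_ge[OF fin] by (intro bexI[of _ I]) auto
  qed
  then obtain I where I: "I \<in> M" "\<And>J. J \<in> M \<Longrightarrow> norm (p J) \<le> norm (p I)" by blast
  have IV: "I \<subseteq> V" using I(1) M by blast
  have "\<exists>\<sigma>\<subseteq>I. card \<sigma> + 1 \<le> N \<and> (\<forall>q \<in> G \<inter> (\<Inter>v\<in>\<sigma>. C v). norm (p I) \<le> norm q)"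
    using IV I(1) p[OF I(1)] unfolding X_def
    by (intro basis_of_norm_minimum[OF finite_subset[OF IV M(1)] _ S G(1-3) toG' shrink[OF IV] slack[OF I(1)]] conv)
       auto
  then obtain \<sigma> where \<sigma>: "\<sigma> \<subseteq> I" "card \<sigma> + 1 \<le> N" and min: "\<And>q. q \<in> X \<sigma> \<Longrightarrow> norm (p I) \<le> norm q"
    unfolding X_def by blast
  have \<sigma>M: "\<sigma> \<in> M" using M(4) I(1) \<sigma>(1) by blast
  have pI: "p I \<in> X \<sigma>" using p(1)[OF I(1)] \<sigma>(1) unfolding X_def by blast
  define \<tau> where "\<tau> = {v \<in> V. p I \<in> C v}"
  have "insert v \<sigma> \<notin> M" if v: "v \<in> V - \<tau>" for v
  proof
    assume ins: "insert v \<sigma> \<in> M"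
    have q: "p (insert v \<sigma>) \<in> X \<sigma>" "p (insert v \<sigma>) \<in> C v"
      using p(1)[OF ins] unfolding X_def by auto
    \<comment> \<open>By the choice of \<open>I\<close>, the minimiser for
      \<open>insert v \<sigma>\<close> is no longer than \<open>p I\<close>, so it is also a point
      of \<open>X \<sigma>\<close> nearest to the origin and must equal \<open>p I\<close>.\<close>
    have "norm (p (insert v \<sigma>)) \<le> norm y" if "y \<in> X \<sigma>" for y
      using I(2)[OF ins] min[OF that] by linarith
    then have "p (insert v \<sigma>) = p I"
      using any_closest_point_unique[OF X(2)[OF \<sigma>M] X(1)[OF \<sigma>M] q(1) pI, of 0] min by simp
    then show False using q(2) v unfolding \<tau>_def by auto
  qed
  then have "matroid_rank M (V - \<tau>) \<le> card \<sigma>"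
    by (intro matroid_rank_le[OF mat \<sigma>M]) auto
  moreover have "p I \<in> G \<inter> (\<Inter>v\<in>\<tau>. C v)" using pI unfolding X_def \<tau>_def by blast
  moreover have "\<tau> \<subseteq> V" unfolding \<tau>_def by blast
  ultimately show ?thesis using \<sigma>(2) min \<sigma>M unfolding X_def by (meson add_le_mono1 order_trans)
qed

subsection \<open>Determinants of positive definite matrices\<close>

lemma symmetric_inner_matrix:
  fixes A :: "real ^ 'n ^ 'n"
  assumes "transpose A = A"
  shows "x \<bullet> (A *v y) = y \<bullet> (A *v x)"
  using dot_lmul_matrix[of x A y] transpose_matrix_vector[of A x] assms by (simp add: inner_commute)

text \<open>The form at \<open>y + t z\<close> is a nonnegative quadratic in \<open>t\<close> that
  vanishes at 0, so its linear coefficient is zero.\<close>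

lemma semidefinite_null_vector:
  fixes Q :: "real ^ 'n ^ 'n"
  assumes sym: "transpose Q = Q" and S: "subspace S"
    and psd: "\<And>z. z \<in> S \<Longrightarrow> 0 \<le> z \<bullet> (Q *v z)"
    and y: "y \<in> S" "y \<bullet> (Q *v y) = 0" and z: "z \<in> S"
  shows "z \<bullet> (Q *v y) = 0"
proof (rule ccontr)
  define b where "b = z \<bullet> (Q *v y)"
  define c where "c = z \<bullet> (Q *v z)"
  assume "\<not> ?thesis"
  then have b: "b \<noteq> 0" by (simp add: b_def)
  have c: "0 \<le> c" using psd[OF z] by (simp add: c_def)
  \<comment> \<open>Near the minimiser \<open>- b / c\<close>, but also defined for
    \<open>c = 0\<close>.\<close>
  define t where "t = - b / (c + 1)"
  have "y + t *\<^sub>R z \<in> S" using S y(1) z by (simp add: subspace_add subspace_mul)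
  from psd[OF this] have "0 \<le> 2 * t * b + t * t * c"
    using y(2) symmetric_inner_matrix[OF sym, of y z]
    by (simp add: matrix_vector_right_distrib matrix_vector_mult_scaleR inner_add_left inner_add_right b_def c_def algebra_simps)
  also have "\<dots> = - (b * b * (c + 2)) / ((c + 1) * (c + 1))"
    using c by (simp add: t_def divide_simps) (simp add: algebra_simps)
  also have "\<dots> < 0"
  proof -
    have "0 < b * b" using b by (simp add: zero_less_mult_iff neq_iff disj_commute)
    then have "0 < b * b * (c + 2)" "0 < (c + 1) * (c + 1)" using c by simp_all
    then show ?thesis by (intro divide_neg_pos) simp_all
  qed
  finally show False by simp
qed

text \<open>The next vector maximises the Rayleigh quotient of \<open>B\<close> relative to
  \<open>A\<close> on the \<open>A\<close>-orthogonal complement \<open>S\<close> of those already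
  found.\<close>

lemma simultaneous_eigenvectors:
  fixes A B :: "real ^ 'n ^ 'n"
  assumes A: "A \<in> pos_def_matrices" and B: "transpose B = B" and "k \<le> CARD('n)"
  shows "\<exists>W. finite W \<and> card W = k \<and>
           (\<forall>x\<in>W. x \<bullet> (A *v x) = 1 \<and> (\<exists>l. B *v x = l *\<^sub>R (A *v x))) \<and>
           (\<forall>x\<in>W. \<forall>y\<in>W. x \<noteq> y \<longrightarrow> x \<bullet> (A *v y) = 0)"
  using assms(3)
proof (induction k)
  case 0
  show ?case by (rule exI[of _ "{}"]) simp
next
  case (Suc k)
  have symA: "transpose A = A" and pos: "\<And>x. x \<noteq> 0 \<Longrightarrow> 0 < x \<bullet> (A *v x)"
    using A by (auto simp: pos_def_matrices_def)
  obtain W where W: "finite W" "card W = k"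
    and eig: "\<And>x. x \<in> W \<Longrightarrow> x \<bullet> (A *v x) = 1" "\<And>x. x \<in> W \<Longrightarrow> \<exists>l. B *v x = l *\<^sub>R (A *v x)"
    and orth: "\<And>x y. x \<in> W \<Longrightarrow> y \<in> W \<Longrightarrow> x \<noteq> y \<Longrightarrow> x \<bullet> (A *v y) = 0"
    using Suc by auto
  define S where "S = {y. \<forall>x\<in>W. y \<bullet> (A *v x) = 0}"
  have S: "subspace S" unfolding S_def subspace_def by (auto simp: inner_add_left)
  \<comment> \<open>Fewer than \<open>CARD('n)\<close> linear conditions define \<open>S\<close>, so
    it contains a nonzero vector.\<close>
  have "dim ((*v) A ` W) \<le> card ((*v) A ` W)" using W(1) by (simp add: dim_le_card')
  also have "\<dots> \<le> k" using W card_image_le by blast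
  also have "k < DIM(real ^ 'n)" using Suc.prems by simp
  finally obtain y0 where y0: "y0 \<noteq> 0" "\<And>y. y \<in> span ((*v) A ` W) \<Longrightarrow> orthogonal y0 y"
    using orthogonal_to_subspace_exists by blast
  then have "y0 \<in> S" by (auto simp: S_def orthogonal_def span_base)
  define f where "f z = (z \<bullet> (B *v z)) / (z \<bullet> (A *v z))" for z
  have "closed S" using S by (rule closed_subspace)
  then have "compact (sphere 0 1 \<inter> S)" by (simp add: compact_Int_closed)
  moreover have "(1 / norm y0) *\<^sub>R y0 \<in> sphere 0 1 \<inter> S"
    using y0(1) \<open>y0 \<in> S\<close> S by (simp add: subspace_mul)
  moreover have "continuous_on (sphere 0 1 \<inter> S) f"
  proof -
    have "z \<bullet> (A *v z) \<noteq> 0" if "z \<in> sphere 0 1 \<inter> S" for z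
      using pos[of z] that by fastforce
    then show ?thesis unfolding f_def
      by (intro continuous_intros matrix_vector_mult_linear_continuous_on) auto
  qed
  ultimately obtain y where y: "y \<in> sphere 0 1 \<inter> S" "\<And>z. z \<in> sphere 0 1 \<inter> S \<Longrightarrow> f z \<le> f y"
    using continuous_attains_sup[of "sphere 0 1 \<inter> S" f] by blast
  have yS: "y \<in> S" and ny: "y \<noteq> 0" using y(1) by auto
  define l where "l = f y"
  \<comment> \<open>Maximality of \<open>l\<close> makes \<open>Q\<close> semidefinite on
    \<open>S\<close> with null vector \<open>y\<close>. So \<open>Q *v y\<close> is orthogonal to
    \<open>S\<close>, by the eigenvector equations to \<open>W\<close>, and hence to
    everything.\<close>
  define Q where "Q = l *\<^sub>R A - B"
  have Qv: "Q *v z = l *\<^sub>R (A *v z) - B *v z" for z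
    by (simp add: Q_def matrix_vector_mult_diff_rdistrib scaleR_matrix_vector_assoc)
  have symQ: "transpose Q = Q" using symA B by (simp add: Q_def transpose_def vec_eq_iff)
  have psd: "0 \<le> z \<bullet> (Q *v z)" if z: "z \<in> S" for z
  proof (cases "z = 0")
    case False
    define u where "u = (1 / norm z) *\<^sub>R z"
    have "u \<in> sphere 0 1 \<inter> S" using False z S by (simp add: u_def subspace_mul)
    then have "f u \<le> l" using y(2) by (simp add: l_def)
    moreover have "f u = f z" using False
      by (simp add: f_def u_def matrix_vector_mult_scaleR)
    ultimately show ?thesis using pos[OF False]
      by (simp add: f_def Qv inner_diff_right pos_divide_le_eq)
  qed simp
  have "y \<bullet> (Q *v y) = 0"
    using pos[OF ny] by (simp add: Qv inner_diff_right l_def f_def)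
  then have QS: "z \<bullet> (Q *v y) = 0" if "z \<in> S" for z
    using semidefinite_null_vector[OF symQ S psd yS] that by blast
  have QW: "x \<bullet> (Q *v y) = 0" if x: "x \<in> W" for x
  proof -
    obtain m where "B *v x = m *\<^sub>R (A *v x)" using eig(2)[OF x] by blast
    then have "y \<bullet> (Q *v x) = 0" using yS x by (simp add: Qv inner_diff_right S_def)
    then show ?thesis using symmetric_inner_matrix[OF symQ] by metis
  qed
  have "z \<bullet> (Q *v y) = 0" for z
  proof -
    \<comment> \<open>The \<open>A\<close>-orthogonal projection of \<open>z\<close> onto the span
      of \<open>W\<close>.\<close>
    define p where "p = (\<Sum>x\<in>W. (z \<bullet> (A *v x)) *\<^sub>R x)"
    have "p \<bullet> (A *v x) = z \<bullet> (A *v x)" if x: "x \<in> W" for x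
    proof -
      have "p \<bullet> (A *v x) = (\<Sum>x'\<in>W. (z \<bullet> (A *v x')) * (x' \<bullet> (A *v x)))"
        by (simp add: p_def inner_sum_left)
      also have "\<dots> = (\<Sum>x'\<in>W. if x' = x then z \<bullet> (A *v x) else 0)"
        using orth eig(1) x by (intro sum.cong) auto
      finally show ?thesis using W(1) x by simp
    qed
    then have "z - p \<in> S" by (simp add: S_def inner_diff_left)
    then have "(z - p) \<bullet> (Q *v y) = 0" by (rule QS)
    moreover have "p \<bullet> (Q *v y) = 0" by (simp add: p_def inner_sum_left QW)
    ultimately show ?thesis by (simp add: inner_diff_left)
  qed
  then have "Q *v y = 0" by (metis inner_eq_zero_iff)
  then have By: "B *v y = l *\<^sub>R (A *v y)" by (simp add: Qv)
  define w where "w = (1 / sqrt (y \<bullet> (A *v y))) *\<^sub>R y"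
  have w: "w \<bullet> (A *v w) = 1" "B *v w = l *\<^sub>R (A *v w)"
    using pos[OF ny] By by (simp_all add: w_def matrix_vector_mult_scaleR real_sqrt_mult[symmetric] mult.commute)
  have wS: "w \<in> S" using yS S by (simp add: w_def subspace_mul)
  have "w \<notin> W" using wS w(1) by (auto simp: S_def)
  moreover have "w \<bullet> (A *v x) = 0" "x \<bullet> (A *v w) = 0" if "x \<in> W" for x
    using wS that symmetric_inner_matrix[OF symA, of x w] by (auto simp: S_def)
  ultimately show ?case
    using W eig orth w by (intro exI[of _ "insert w W"]) auto
qed

text \<open>With the common eigenvectors as columns of \<open>P\<close>, congruence by
  \<open>P\<close> turns \<open>A\<close> into the identity and \<open>B\<close> into a diagonal
  matrix; \<open>D\<close> is the square of \<open>det P\<close>.\<close>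

lemma simultaneous_diagonalization:
  fixes A B :: "real ^ 'n ^ 'n"
  assumes A: "A \<in> pos_def_matrices" and B: "B \<in> pos_def_matrices"
  obtains D :: real and l :: "'n \<Rightarrow> real" where "0 < D" "\<And>i. 0 < l i"
    "\<And>a b. D * det (a *\<^sub>R A + b *\<^sub>R B) = (\<Prod>i\<in>UNIV. a + b * l i)"
proof -
  have symB: "transpose B = B" and posB: "\<And>x. x \<noteq> 0 \<Longrightarrow> 0 < x \<bullet> (B *v x)"
    using B by (auto simp: pos_def_matrices_def)
  obtain W where W: "finite W" "card W = CARD('n)"
    and eig: "\<And>x. x \<in> W \<Longrightarrow> x \<bullet> (A *v x) = 1" "\<And>x. x \<in> W \<Longrightarrow> \<exists>l. B *v x = l *\<^sub>R (A *v x)"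
    and orth: "\<And>x y. x \<in> W \<Longrightarrow> y \<in> W \<Longrightarrow> x \<noteq> y \<Longrightarrow> x \<bullet> (A *v y) = 0"
    using simultaneous_eigenvectors[OF A symB order_refl] by auto
  obtain w where w: "bij_betw w (UNIV :: 'n set) W"
    using finite_same_card_bij[of "UNIV :: 'n set" W] W by auto
  have wW: "w i \<in> W" for i using w by (auto simp: bij_betw_def)
  have wi: "w i = w j \<longleftrightarrow> i = j" for i j using w by (auto simp: bij_betw_def inj_on_def)
  define P :: "real ^ 'n ^ 'n" where "P = (\<chi> i j. w j $ i)"
  have PCP: "(transpose P ** (C ** P)) $ i $ j = w i \<bullet> (C *v w j)" for C i j
    by (simp add: P_def matrix_matrix_mult_def matrix_vector_mult_def transpose_def inner_vec_def)
  define l where "l i = w i \<bullet> (B *v w i)" for i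
  have wA: "w i \<bullet> (A *v w j) = (if i = j then 1 else 0)" for i j
    using eig(1) orth wW wi by auto
  have wB: "w i \<bullet> (B *v w j) = (if i = j then l i else 0)" for i j
    using eig(2)[OF wW, of j] wA[of i j] by (auto simp: l_def)
  have *: "det P * det P * det (a *\<^sub>R A + b *\<^sub>R B) = (\<Prod>i\<in>UNIV. a + b * l i)" for a b
  proof -
    define C where "C = a *\<^sub>R A + b *\<^sub>R B"
    have C: "w i \<bullet> (C *v w j) = a * (w i \<bullet> (A *v w j)) + b * (w i \<bullet> (B *v w j))" for i j
      by (simp add: C_def matrix_vector_mult_add_rdistrib scaleR_matrix_vector_assoc[symmetric] inner_add_right)
    have "det (transpose P ** (C ** P)) = (\<Prod>i\<in>UNIV. (transpose P ** (C ** P)) $ i $ i)"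
      by (intro det_diagonal) (simp add: PCP C wA wB)
    also have "\<dots> = (\<Prod>i\<in>UNIV. a + b * l i)" by (simp add: PCP C wA wB)
    finally show ?thesis by (simp add: det_mul C_def mult_ac)
  qed
  have "det P \<noteq> 0" using *[of 1 0] by auto
  then have "0 < det P * det P" by (metis linorder_neqE mult_neg_neg mult_pos_pos)
  moreover have "0 < l i" for i using posB[of "w i"] wA[of i i] by (cases "w i = 0") (simp_all add: l_def)
  ultimately show ?thesis using that * by blast
qed

text \<open>After diagonalisation, weighted AM-GM on each factor shows that the determinant is at
  least a weighted geometric mean of \<open>det A\<close> and \<open>det B\<close>.\<close>

lemma det_quasiconcave:
  fixes A B :: "real ^ 'n ^ 'n"
  assumes A: "A \<in> pos_def_matrices" and B: "B \<in> pos_def_matrices" and s: "0 \<le> s" "s \<le> 1"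
  shows "min (det A) (det B) \<le> det ((1 - s) *\<^sub>R A + s *\<^sub>R B)"
proof -
  obtain D and l :: "'n \<Rightarrow> real" where D: "0 < D" and l: "\<And>i. 0 < l i"
    and eq: "\<And>a b. D * det (a *\<^sub>R A + b *\<^sub>R B) = (\<Prod>i\<in>UNIV. a + b * l i)"
    using simultaneous_diagonalization[OF A B] by blast
  define L where "L = prod l UNIV"
  have L: "0 < L" using l by (simp add: L_def prod_pos)
  have "l i powr s \<le> (1 - s) + s * l i" for i
    using Youngs_inequality_0[of "1 - s" s 1 "l i"] s l[of i] by simp
  then have "(\<Prod>i\<in>UNIV. l i powr s) \<le> (\<Prod>i\<in>UNIV. (1 - s) + s * l i)"
    by (intro prod_mono) simp
  also have "(\<Prod>i\<in>UNIV. l i powr s) = L powr s"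
    using l by (simp add: L_def prod_powr_distrib less_imp_le)
  finally have "L powr s \<le> D * det ((1 - s) *\<^sub>R A + s *\<^sub>R B)" by (simp add: eq)
  moreover have "min 1 L \<le> L powr s"
  proof (cases "1 \<le> L")
    case True
    then show ?thesis using s ge_one_powr_ge_zero[of L s] by simp
  next
    case False
    then show ?thesis using s L powr_mono'[of s 1 L] by simp
  qed
  moreover have "D * det A = 1" "D * det B = L" using eq[of 1 0] eq[of 0 1] by (simp_all add: L_def)
  ultimately have "D * min (det A) (det B) \<le> D * det ((1 - s) *\<^sub>R A + s *\<^sub>R B)"
    using D by (simp add: min_mult_distrib_left)
  then show ?thesis using D by simp
qed

section \<open>Convex and closed superlevel sets of the determinant\<close>

lemma det_scaleR:
  fixes A :: "real ^ 'n ^ 'n"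
  shows "det (c *\<^sub>R A) = c ^ CARD('n) * det A"
  by (simp add: det_def sum_distrib_left prod.distrib mult_ac)

lemma pos_def_matrices_scaleR: "0 < c \<Longrightarrow> A \<in> pos_def_matrices \<Longrightarrow> c *\<^sub>R A \<in> pos_def_matrices"
  by (auto simp: pos_def_matrices_def scaleR_matrix_vector_assoc[symmetric] transpose_def vec_eq_iff)

lemma convex_pos_def_matrices: "convex (pos_def_matrices :: (real ^ 'n ^ 'n) set)"
proof (rule convexI)
  fix A B :: "real ^ 'n ^ 'n" and u v :: real
  assume AB: "A \<in> pos_def_matrices" "B \<in> pos_def_matrices" and uv: "0 \<le> u" "0 \<le> v" "u + v = 1"
  have "0 < x \<bullet> ((u *\<^sub>R A + v *\<^sub>R B) *v x)" if "x \<noteq> 0" for x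
  proof -
    have pos: "0 < x \<bullet> (A *v x)" "0 < x \<bullet> (B *v x)" using AB that by (auto simp: pos_def_matrices_def)
    have "0 < u * (x \<bullet> (A *v x)) + v * (x \<bullet> (B *v x))"
      using pos uv by (cases "u = 0") (auto intro: add_pos_nonneg)
    then show ?thesis
      by (simp add: matrix_vector_mult_add_rdistrib scaleR_matrix_vector_assoc[symmetric] inner_add_right)
  qed
  moreover have "transpose (u *\<^sub>R A + v *\<^sub>R B) = u *\<^sub>R A + v *\<^sub>R B"
    using AB by (simp add: pos_def_matrices_def transpose_def vec_eq_iff)
  ultimately show "u *\<^sub>R A + v *\<^sub>R B \<in> pos_def_matrices" by (simp add: pos_def_matrices_def)
qed

lemma convex_pos_def_det:
  "convex {A \<in> pos_def_matrices :: (real ^ 'n ^ 'n) set. c \<le> det A}"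
  "convex {A \<in> pos_def_matrices :: (real ^ 'n ^ 'n) set. c < det A}"
  unfolding convex_alt
proof safe
  fix A B :: "real ^ 'n ^ 'n" and u :: real
  assume AB: "A \<in> pos_def_matrices" "B \<in> pos_def_matrices" and u: "0 \<le> u" "u \<le> 1"
  show PD: "(1 - u) *\<^sub>R A + u *\<^sub>R B \<in> pos_def_matrices"
    using convexD_alt[OF convex_pos_def_matrices AB] u by simp
  then show "(1 - u) *\<^sub>R A + u *\<^sub>R B \<in> pos_def_matrices" .
  show "c \<le> det ((1 - u) *\<^sub>R A + u *\<^sub>R B)" if "c \<le> det A" "c \<le> det B"
    using det_quasiconcave[OF AB u] that by linarith
  show "c < det ((1 - u) *\<^sub>R A + u *\<^sub>R B)" if "c < det A" "c < det B"
    using det_quasiconcave[OF AB u] that by linarith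
qed

text \<open>Strictness comes from homogeneity: \<open>B\<close> may be scaled down to determinant
  \<open>c\<close> before quasiconcavity is applied, and scaling back gains a factor above 1. This
  supplies the condition \<open>toG'\<close>.\<close>

lemma det_convex_combination_gt:
  fixes A B :: "real ^ 'n ^ 'n"
  assumes A: "A \<in> pos_def_matrices" "c \<le> det A" and B: "B \<in> pos_def_matrices" "c < det B"
    and c: "0 < c" and s: "0 < s" "s \<le> 1"
  shows "c < det ((1 - s) *\<^sub>R A + s *\<^sub>R B)"
proof -
  define t where "t = root CARD('n) (c / det B)"
  have t: "0 < t" "t < 1" "t ^ CARD('n) * det B = c"
    using B(2) c by (simp_all add: t_def)
  have tB: "t *\<^sub>R B \<in> pos_def_matrices" "det (t *\<^sub>R B) = c"
    using t B(1) by (simp_all add: pos_def_matrices_scaleR det_scaleR)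
  \<comment> \<open>The combination is \<open>k > 1\<close> times a convex combination of \<open>A\<close> and \<open>t *\<^sub>R B\<close>.\<close>
  define k where "k = 1 - s + s / t"
  define r where "r = s / t / k"
  have "s < s / t" using t s by (simp add: less_divide_eq)
  then have k: "1 < k" by (simp add: k_def)
  have r: "0 \<le> r" "r \<le> 1"
    using k s t by (simp_all add: r_def divide_le_eq_1 del: divide_divide_eq_left) (simp add: k_def)
  have kr: "k * r = s / t" "k * (1 - r) = 1 - s"
    using k by (simp_all add: r_def k_def right_diff_distrib)
  have "k *\<^sub>R ((1 - r) *\<^sub>R A + r *\<^sub>R t *\<^sub>R B) = (k * (1 - r)) *\<^sub>R A + ((k * r) * t) *\<^sub>R B"
    by (simp add: scaleR_right_distrib mult_ac)
  also have "\<dots> = (1 - s) *\<^sub>R A + s *\<^sub>R B" using t(1) by (simp only: kr) simp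
  finally have "det ((1 - s) *\<^sub>R A + s *\<^sub>R B) = k ^ CARD('n) * det ((1 - r) *\<^sub>R A + r *\<^sub>R t *\<^sub>R B)"
    by (metis det_scaleR)
  moreover have "c \<le> det ((1 - r) *\<^sub>R A + r *\<^sub>R t *\<^sub>R B)"
    using det_quasiconcave[OF A(1) tB(1) r] A(2) tB(2) by linarith
  moreover have "1 < k ^ CARD('n)" using k by (simp add: one_less_power)
  ultimately have "det ((1 - s) *\<^sub>R A + s *\<^sub>R B) \<ge> k ^ CARD('n) * c" "k ^ CARD('n) * c > 1 * c"
    using c by (simp_all add: mult_left_mono)
  then show ?thesis by simp
qed

lemma continuous_on_det [continuous_intros]:
  fixes f :: "'a::topological_space \<Rightarrow> real ^ 'n ^ 'n"
  assumes "continuous_on S f"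
  shows "continuous_on S (\<lambda>x. det (f x))"
  unfolding det_def by (intro continuous_intros assms)

lemma continuous_on_matrix_vector [continuous_intros]:
  fixes f :: "'a::topological_space \<Rightarrow> real ^ 'n ^ 'm"
  assumes "continuous_on S f"
  shows "continuous_on S (\<lambda>x. f x *v z)"
  unfolding matrix_vector_mult_def by (intro continuous_intros assms)

text \<open>Once \<open>det A\<close> is bounded below by \<open>c > 0\<close>, semidefiniteness
  suffices: a null vector of the form would lie in the kernel of an invertible matrix.\<close>

lemma closed_pos_def_det_ge:
  assumes "0 < c"
  shows "closed {A \<in> pos_def_matrices :: (real ^ 'n ^ 'n) set. c \<le> det A}"
proof -
  have "{A \<in> pos_def_matrices :: (real ^ 'n ^ 'n) set. c \<le> det A} =
      {A. transpose A = A} \<inter> (\<Inter>x. {A. 0 \<le> x \<bullet> (A *v x)}) \<inter> {A. c \<le> det A}" (is "?L = ?R")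
  proof (intro equalityI subsetI)
    fix A assume "A \<in> ?L"
    then have "0 \<le> x \<bullet> (A *v x)" for x by (cases "x = 0") (auto simp: pos_def_matrices_def less_imp_le)
    then show "A \<in> ?R" using \<open>A \<in> ?L\<close> by (auto simp: pos_def_matrices_def)
  next
    fix A assume A: "A \<in> ?R"
    have "0 < x \<bullet> (A *v x)" if "x \<noteq> 0" for x
    proof (rule ccontr)
      assume "\<not> ?thesis"
      then have "x \<bullet> (A *v x) = 0" using A by (simp add: order.antisym not_less)
      then have "z \<bullet> (A *v x) = 0" for z
        using semidefinite_null_vector[of A UNIV x z] A by auto
      then have "A *v x = 0" by (metis inner_eq_zero_iff)
      moreover have "invertible A" using A assms by (simp add: invertible_det_nz)
      ultimately show False using that
        by (metis invertible_left_inverse matrix_left_invertible_ker)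
    qed
    then show "A \<in> ?L" using A by (simp add: pos_def_matrices_def)
  qed
  moreover have "closed ?R"
    unfolding transpose_def
    by (intro closed_Int closed_INT ballI closed_Collect_eq closed_Collect_le continuous_intros)
  ultimately show ?thesis by simp
qed

text \<open>Unit vectors and elementary symmetric matrices span, the latter indexed by sets of one
  or two indices: in total d + d + d(d-1)/2 generators.\<close>

lemma dim_symmetric_matrices:
  "2 * dim {q :: (real ^ 'n) \<times> (real ^ 'n ^ 'n). transpose (snd q) = snd q} \<le> CARD('n) * (CARD('n) + 3)"
proof -
  define T :: "'n set set" where "T = {s. card s = 1} \<union> {s. card s = 2}"
  define E :: "'n set \<Rightarrow> (real ^ 'n) \<times> (real ^ 'n ^ 'n)"
    where "E s = (0, \<chi> i j. if {i, j} = s then 1 else 0)" for s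
  define X where "X = range (\<lambda>i. (axis i 1, 0) :: (real ^ 'n) \<times> (real ^ 'n ^ 'n)) \<union> E ` T"
  have T: "{i, j} \<in> T" for i j by (cases "i = j") (auto simp: T_def)
  have "{q. transpose (snd q) = snd q} \<subseteq> span X"
  proof clarsimp
    fix a :: "real ^ 'n" and A :: "real ^ 'n ^ 'n" assume sym: "transpose A = A"
    \<comment> \<open>The matrix entry at an unordered pair; symmetry makes the choice
      unique.\<close>
    define c where "c s = (SOME y. \<exists>i j. s = {i, j} \<and> y = A $ i $ j)" for s
    have "A $ i $ j = A $ j $ i" for i j using sym by (metis transpose_def vec_lambda_beta)
    then have c: "c {i, j} = A $ i $ j" for i j
      unfolding c_def by (intro some_equality) (auto simp: doubleton_eq_iff)
    have "(\<Sum>s\<in>T. c s *\<^sub>R E s) = (0, A)"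
    proof (rule prod_eqI)
      show "fst (\<Sum>s\<in>T. c s *\<^sub>R E s) = fst (0, A)" by (simp add: fst_sum E_def)
      have "(\<Sum>s\<in>T. c s * (if {i, j} = s then 1 else 0)) = A $ i $ j" for i j
      proof -
        have "(\<Sum>s\<in>T. c s * (if {i, j} = s then 1 else 0)) = (\<Sum>s\<in>T. if {i, j} = s then c s else 0)"
          by (intro sum.cong) auto
        then show ?thesis using T c by (simp add: sum.delta)
      qed
      then show "snd (\<Sum>s\<in>T. c s *\<^sub>R E s) = snd (0, A)"
        by (simp add: snd_sum E_def vec_eq_iff)
    qed
    moreover have "(\<Sum>i\<in>UNIV. a $ i *\<^sub>R (axis i 1, 0)) = (a, 0 :: real ^ 'n ^ 'n)"
      by (rule prod_eqI) (simp_all add: fst_sum snd_sum vec_eq_iff axis_def if_distrib cong: if_cong)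
    ultimately have "(a, A) = (\<Sum>i\<in>UNIV. a $ i *\<^sub>R (axis i 1, 0)) + (\<Sum>s\<in>T. c s *\<^sub>R E s)"
      by simp
    also have "\<dots> \<in> span X"
      by (intro span_add span_sum span_scale span_base) (auto simp: X_def)
    finally show "(a, A) \<in> span X" .
  qed
  then have "dim {q :: (real ^ 'n) \<times> (real ^ 'n ^ 'n). transpose (snd q) = snd q} \<le> card X"
    by (intro dim_le_card) (auto simp: X_def)
  also have "card X \<le> CARD('n) + card T"
    unfolding X_def by (meson add_mono card_Un_le card_image_le finite_code le_trans)
  also have "card T \<le> CARD('n) + (CARD('n) choose 2)"
    using card_Un_le[of "{s :: 'n set. card s = 1}" "{s. card s = 2}"]
      n_subsets[of "UNIV :: 'n set" 1] n_subsets[of "UNIV :: 'n set" 2] by (simp add: T_def)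
  finally have "2 * dim {q :: (real ^ 'n) \<times> (real ^ 'n ^ 'n). transpose (snd q) = snd q}
      \<le> 4 * CARD('n) + 2 * (CARD('n) choose 2)" by simp
  also have "2 * (CARD('n) choose 2) = CARD('n) * (CARD('n) - 1)" by (simp add: choose_two)
  also have "4 * CARD('n) + \<dots> = CARD('n) * (CARD('n) + 3)"
    by (cases "CARD('n)") (simp_all add: algebra_simps)
  finally show ?thesis by simp
qed

subsection \<open>Copies of a set inside convex sets\<close>

text \<open>Copies are based at a point \<open>k\<close> of \<open>K\<close>, so that scaling \<open>A\<close> down keeps them inside a convex set.\<close>

definition copies_in :: "(real ^ 'n) set \<Rightarrow> real ^ 'n \<Rightarrow> (real ^ 'n) set \<Rightarrow> ((real ^ 'n) \<times> (real ^ 'n ^ 'n)) set" where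
  "copies_in K k X = {q. \<forall>x\<in>K. fst q + snd q *v (x - k) \<in> X}"

lemma convex_copies_in:
  fixes X :: "(real ^ 'n) set"
  shows "convex X \<Longrightarrow> convex (copies_in K k X)"
proof (rule convexI)
  fix p q :: "(real ^ 'n) \<times> (real ^ 'n ^ 'n)" and u v :: real
  assume X: "convex X" and pq: "p \<in> copies_in K k X" "q \<in> copies_in K k X"
    and uv: "0 \<le> u" "0 \<le> v" "u + v = 1"
  have "fst (u *\<^sub>R p + v *\<^sub>R q) + snd (u *\<^sub>R p + v *\<^sub>R q) *v y =
      u *\<^sub>R (fst p + snd p *v y) + v *\<^sub>R (fst q + snd q *v y)" for y
    by (simp add: matrix_vector_mult_add_rdistrib scaleR_matrix_vector_assoc[symmetric] scaleR_right_distrib)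
  then show "u *\<^sub>R p + v *\<^sub>R q \<in> copies_in K k X"
    using pq convexD[OF X _ _ uv] by (simp add: copies_in_def)
qed

lemma closed_copies_in:
  assumes "closed X"
  shows "closed (copies_in K k X)"
proof -
  have "copies_in K k X = (\<Inter>x\<in>K. (\<lambda>q. fst q + snd q *v (x - k)) -` X)"
    by (auto simp: copies_in_def)
  moreover have "closed ((\<lambda>q. fst q + snd q *v (x - k)) -` X)" for x
    using assms by (intro closed_vimage continuous_intros)
  ultimately show ?thesis by auto
qed

text \<open>Since \<open>k \<in> K\<close>, the base point \<open>b\<close> lies in
  \<open>X\<close>, and shrinking moves every point of the copy along a segment towards
  \<open>b\<close>.\<close>

lemma copies_in_shrink:
  assumes "(b, A) \<in> copies_in K k X" "convex X" "k \<in> K" "0 \<le> t" "t \<le> 1"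
  shows "(b, t *\<^sub>R A) \<in> copies_in K k X"
proof -
  have "b \<in> X" using assms(1,3) by (force simp: copies_in_def)
  have "b + (t *\<^sub>R A) *v y = (1 - t) *\<^sub>R b + t *\<^sub>R (b + A *v y)" for y
    by (simp add: scaleR_matrix_vector_assoc[symmetric] algebra_simps)
  then show ?thesis
    using assms \<open>b \<in> X\<close> by (auto simp: copies_in_def intro!: convexD_alt)
qed

text \<open>The copy is itself open. This allows closures of the given open sets to be used and
  undone at the end.\<close>

lemma affine_copy_subset_interior:
  assumes "open K" "invertible A" "affine_copy a A K \<subseteq> X"
  shows "affine_copy a A K \<subseteq> interior X"
proof -
  have "surj ((*v) A)" using assms(2) by (simp add: invertible_eq_bij bij_is_surj)
  then have "open ((+) a ` ((*v) A ` K))"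
    using assms(1) by (intro open_translation open_surjective_linear_image) auto
  moreover have "affine_copy a A K = (+) a ` ((*v) A ` K)" by (auto simp: affine_copy_def)
  ultimately show ?thesis using assms(3) by (simp add: interior_maximal)
qed

text \<open>Instance of \<open>matroid_norm_minimum\<close> with the two determinant conditions as
  \<open>G\<close> and \<open>G'\<close>. The bound \<open>R\<close> on the solution does not
  involve \<open>c\<close>, which the limit \<open>c \<rightarrow> 1\<close> relies on.\<close>

lemma matroid_copies_det_ge:
  fixes K :: "(real ^ 'n) set" and X :: "'v \<Rightarrow> (real ^ 'n) set"
  assumes mat: "matroid V M" and k: "k \<in> K"
    and X: "\<And>v. v \<in> V \<Longrightarrow> convex (X v)" "\<And>v. v \<in> V \<Longrightarrow> closed (X v)"
    and q: "\<And>I. I \<in> M \<Longrightarrow> q I \<in> (\<Inter>v\<in>I. copies_in K k (X v))"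
    and PD: "\<And>I. I \<in> M \<Longrightarrow> snd (q I) \<in> pos_def_matrices"
    and c: "0 < c" "\<And>I. I \<in> M \<Longrightarrow> c < det (snd (q I))"
    and R: "\<And>I. I \<in> M \<Longrightarrow> norm (q I) \<le> R"
  shows "\<exists>\<tau>\<subseteq>V. matroid_rank M (V - \<tau>) + 1 \<le> CARD('n) * (CARD('n) + 3) div 2 \<and>
           (\<exists>p\<in>\<Inter>v\<in>\<tau>. copies_in K k (X v). snd p \<in> pos_def_matrices \<and> c \<le> det (snd p) \<and> norm p \<le> R)"
proof -
  define C where "C v = copies_in K k (X v)" for v
  define S where "S = {p :: (real ^ 'n) \<times> (real ^ 'n ^ 'n). transpose (snd p) = snd p}"
  define G :: "((real ^ 'n) \<times> (real ^ 'n ^ 'n)) set"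
    where "G = snd -` {A \<in> pos_def_matrices. c \<le> det A}"
  define G' :: "((real ^ 'n) \<times> (real ^ 'n ^ 'n)) set"
    where "G' = snd -` {A \<in> pos_def_matrices. c < det A}"
  have "\<exists>\<tau>\<subseteq>V. matroid_rank M (V - \<tau>) + 1 \<le> CARD('n) * (CARD('n) + 3) div 2 \<and>
           (\<exists>p\<in>G \<inter> (\<Inter>v\<in>\<tau>. C v). \<exists>I\<in>M. \<forall>q\<in>G \<inter> (\<Inter>v\<in>I. C v). norm p \<le> norm q)"
  proof (rule matroid_norm_minimum[OF mat])
    show "convex (C v)" "closed (C v)" if "v \<in> V" for v
      using X that by (simp_all add: C_def convex_copies_in closed_copies_in)
    show "subspace S" unfolding S_def subspace_def by (simp add: transpose_def vec_eq_iff)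
    show "dim S \<le> CARD('n) * (CARD('n) + 3) div 2"
      using dim_symmetric_matrices[where 'n = 'n] unfolding S_def by linarith
    show "G \<subseteq> S" by (auto simp: G_def S_def pos_def_matrices_def)
    show "G' \<subseteq> G" by (auto simp: G_def G'_def)
    show "convex G" "convex G'"
      unfolding G_def G'_def by (intro convex_linear_vimage linear_snd convex_pos_def_det)+
    show "closed G"
      unfolding G_def by (intro closed_vimage closed_pos_def_det_ge c continuous_intros)
    show "(1 - s) *\<^sub>R p + s *\<^sub>R r \<in> G'" if "p \<in> G" "r \<in> G'" "0 < s" "s \<le> 1" for p r s
      using that c(1) convexD_alt[OF convex_pos_def_matrices, of "snd p" "snd r" s]
      by (simp add: G_def G'_def det_convex_combination_gt)
    show "\<exists>p'\<in>G. (\<forall>v\<in>I. p' \<in> C v) \<and> norm p' < norm p"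
      if I: "I \<subseteq> V" and p: "p \<in> G'" "\<And>v. v \<in> I \<Longrightarrow> p \<in> C v" for I p
    proof -
      obtain b A where bA: "p = (b, A)" by (cases p)
      have A: "A \<in> pos_def_matrices" "c < det A" using p(1) by (auto simp: G'_def bA)
      \<comment> \<open>Scaling by \<open>t\<close> lowers the determinant exactly to
        \<open>c\<close>: the copy stays in \<open>G\<close>, and its norm drops strictly.\<close>
      define t where "t = root CARD('n) (c / det A)"
      have t: "0 < t" "t < 1" "t ^ CARD('n) * det A = c"
        using A(2) c(1) by (simp_all add: t_def)
      have "A \<noteq> 0" using A(2) c(1) det_scaleR[of 0 A] by (auto simp: power_0_left)
      have "norm (t *\<^sub>R A) < norm A" using t \<open>A \<noteq> 0\<close> by simp
      then have "norm (b, t *\<^sub>R A) < norm (b, A)"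
        unfolding norm_Pair by (intro real_sqrt_less_mono add_strict_left_mono power_strict_mono) auto
      moreover have "(b, t *\<^sub>R A) \<in> G"
        using A t by (simp add: G_def pos_def_matrices_scaleR det_scaleR)
      moreover have "(b, t *\<^sub>R A) \<in> C v" if "v \<in> I" for v
        using p(2)[OF that] X(1) I that k t unfolding bA C_def by (intro copies_in_shrink) auto
      ultimately show ?thesis by (auto simp: bA)
    qed
    show "G' \<inter> (\<Inter>v\<in>I. C v) \<noteq> {}" if "I \<in> M" for I
      using q[OF that] PD[OF that] c(2)[OF that] unfolding G'_def C_def by blast
  qed
  then obtain \<tau> p I where \<tau>: "\<tau> \<subseteq> V" "matroid_rank M (V - \<tau>) + 1 \<le> CARD('n) * (CARD('n) + 3) div 2"
    and p: "p \<in> G" "p \<in> (\<Inter>v\<in>\<tau>. C v)" and I: "I \<in> M"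
    and min: "\<And>r. r \<in> G \<inter> (\<Inter>v\<in>I. C v) \<Longrightarrow> norm p \<le> norm r" by blast
  \<comment> \<open>The given copy \<open>q I\<close> competes with the minimiser
    \<open>p\<close>.\<close>
  have "q I \<in> G \<inter> (\<Inter>v\<in>I. C v)"
    using q[OF I] PD[OF I] c(2)[OF I] by (simp add: G_def C_def less_imp_le)
  then have "norm p \<le> R" using min R[OF I] by (meson order_trans)
  then show ?thesis using \<tau> p unfolding G_def C_def by blast
qed

section \<open>Removing the slack by compactness\<close>

lemma compact_det_bound:
  fixes Y :: "((real ^ 'n) \<times> (real ^ 'n ^ 'n)) set"
  assumes "compact Y" "\<And>p. p \<in> Y \<Longrightarrow> det (snd p) < 1"
  shows "\<exists>c<1. \<forall>p\<in>Y. det (snd p) < c"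
proof (cases "Y = {}")
  case True
  then show ?thesis by (intro exI[of _ 0]) simp
next
  case False
  have "continuous_on Y (\<lambda>p. det (snd p))" by (intro continuous_intros)
  then obtain y where y: "y \<in> Y" "\<And>p. p \<in> Y \<Longrightarrow> det (snd p) \<le> det (snd y)"
    using continuous_attains_sup[OF assms(1) False] by blast
  have "det (snd y) < (det (snd y) + 1) / 2" "(det (snd y) + 1) / 2 < 1"
    using assms(2)[OF y(1)] by simp_all
  then show ?thesis using y(2) by (meson le_less_trans)
qed

theorem theorem3p5:
  fixes V :: "'v set" and M :: "'v set set"
    and K :: "(real ^ 'n) set" and F :: "'v \<Rightarrow> (real ^ 'n) set"
  assumes "matroid V M"
    and "open K" and "emeasure lborel K = 1"
    and "\<And>v. v \<in> V \<Longrightarrow> open (F v) \<and> convex (F v)"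
    and "\<And>V'. V' \<subseteq> V \<Longrightarrow> V' \<in> M \<Longrightarrow>
           \<exists>a. \<exists>A\<in>pos_def_matrices. det A = 1 \<and> affine_copy a A K \<subseteq> (\<Inter>v\<in>V'. F v)"
  shows "\<exists>\<tau>\<subseteq>V.
           real (matroid_rank M (V - \<tau>)) \<le> real CARD('n) * (real CARD('n) + 3) / 2 - 1 \<and>
           (\<exists>a. \<exists>A\<in>pos_def_matrices. det A = 1 \<and> affine_copy a A K \<subseteq> (\<Inter>v\<in>\<tau>. F v))"
proof -
  have M: "finite V" "M \<subseteq> Pow V" using assms(1) unfolding matroid_def by auto
  then have finM: "finite M" by (meson finite_Pow_iff finite_subset)
  have "K \<noteq> {}" using assms(3) by auto
  then obtain k where k: "k \<in> K" by blast
  define X where "X v = closure (F v)" for v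
  define C where "C v = copies_in K k (X v)" for v
  have X: "convex (X v)" "closed (X v)" if "v \<in> V" for v
    using assms(4)[OF that] by (simp_all add: X_def convex_closure)
  have "\<exists>p. p \<in> (\<Inter>v\<in>I. C v) \<and> snd p \<in> pos_def_matrices \<and> det (snd p) = 1" if I: "I \<in> M" for I
  proof -
    obtain a A where aA: "A \<in> pos_def_matrices" "det A = 1" "affine_copy a A K \<subseteq> (\<Inter>v\<in>I. F v)"
      using assms(5)[of I] I M by blast
    \<comment> \<open>The translation becomes the image of \<open>k\<close>, as
      \<open>copies_in\<close> is based there.\<close>
    have "(a + A *v k, A) \<in> C v" if "v \<in> I" for v
    proof -
      have "a + A *v x \<in> X v" if "x \<in> K" for x
        using aA(3) \<open>v \<in> I\<close> that closure_subset[of "F v"] unfolding affine_copy_def X_def by blast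
      then show ?thesis by (simp add: C_def copies_in_def matrix_vector_mult_diff_distrib)
    qed
    then show ?thesis using aA by (intro exI[of _ "(a + A *v k, A)"]) simp
  qed
  then obtain q where q: "\<And>I. I \<in> M \<Longrightarrow> q I \<in> (\<Inter>v\<in>I. C v)"
    "\<And>I. I \<in> M \<Longrightarrow> snd (q I) \<in> pos_def_matrices" "\<And>I. I \<in> M \<Longrightarrow> det (snd (q I)) = 1"
    by metis
  define R where "R = Max ((\<lambda>I. norm (q I)) ` M)"
  have R: "norm (q I) \<le> R" if "I \<in> M" for I using finM that by (simp add: R_def)
  define T where "T = {\<tau>. \<tau> \<subseteq> V \<and> matroid_rank M (V - \<tau>) + 1 \<le> CARD('n) * (CARD('n) + 3) div 2}"
  have finT: "finite T" using M(1) by (simp add: T_def)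
  \<comment> \<open>The fixed bound 1/2 makes \<open>Y \<tau>\<close> closed; it contains the
    solutions for every slack value of at least 1/2.\<close>
  define Y where "Y \<tau> = cball 0 R \<inter> (snd -` {A \<in> pos_def_matrices. 1/2 \<le> det A} \<inter> (\<Inter>v\<in>\<tau>. C v))" for \<tau>
  have cY: "compact (Y \<tau>)" if "\<tau> \<in> T" for \<tau>
  proof -
    have "closed (C v)" if "v \<in> \<tau>" for v
      using X(2) that \<open>\<tau> \<in> T\<close> by (auto simp: C_def T_def intro: closed_copies_in)
    then show ?thesis unfolding Y_def
      by (intro compact_Int_closed compact_cball closed_Int closed_INT ballI closed_vimage
          closed_pos_def_det_ge continuous_intros) auto
  qed
  have "\<exists>\<tau>\<in>T. \<exists>p\<in>Y \<tau>. 1 \<le> det (snd p)"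
  proof (rule ccontr)
    assume "\<not> ?thesis"
    then have "\<forall>\<tau>\<in>T. \<exists>c<1. \<forall>p\<in>Y \<tau>. det (snd p) < c"
      using compact_det_bound[OF cY] by (meson not_le)
    then obtain c where c: "\<And>\<tau>. \<tau> \<in> T \<Longrightarrow> c \<tau> < 1" "\<And>\<tau> p. \<tau> \<in> T \<Longrightarrow> p \<in> Y \<tau> \<Longrightarrow> det (snd p) < c \<tau>"
      by metis
    \<comment> \<open>As \<open>T\<close> is finite, one slack value \<open>e < 1\<close> dominates
      all the bounds \<open>c \<tau>\<close>; the solution for \<open>e\<close> then contradicts the
      bound for its own \<open>\<tau>\<close>.\<close>
    define e where "e = Max (insert (1/2) (c ` T))"
    have e: "1/2 \<le> e" "\<And>\<tau>. \<tau> \<in> T \<Longrightarrow> c \<tau> \<le> e"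
      unfolding e_def by (rule Max_ge; use finT in simp)+
    have e1: "e < 1" unfolding e_def using finT c(1) by (subst Max_less_iff) auto
    have "\<exists>\<tau>\<subseteq>V. matroid_rank M (V - \<tau>) + 1 \<le> CARD('n) * (CARD('n) + 3) div 2 \<and>
           (\<exists>p\<in>\<Inter>v\<in>\<tau>. copies_in K k (X v). snd p \<in> pos_def_matrices \<and> e \<le> det (snd p) \<and> norm p \<le> R)"
      using q R e(1) e1 unfolding C_def
      by (intro matroid_copies_det_ge[OF assms(1) k X, where q = q]) auto
    then obtain \<tau> p where "\<tau> \<in> T" "p \<in> (\<Inter>v\<in>\<tau>. C v)" "snd p \<in> pos_def_matrices" "e \<le> det (snd p)" "norm p \<le> R"
      unfolding T_def C_def by blast
    moreover from this have "p \<in> Y \<tau>" using e(1) by (simp add: Y_def)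
    ultimately show False using c(2) e(2) by fastforce
  qed
  then obtain \<tau> b A where \<tau>: "\<tau> \<in> T" and A: "A \<in> pos_def_matrices" "1 \<le> det A"
    and bA: "\<And>v. v \<in> \<tau> \<Longrightarrow> (b, A) \<in> C v" unfolding Y_def by force
  \<comment> \<open>Normalises the determinant to 1; \<open>1 \<le> det A\<close> gives
    \<open>t \<le> 1\<close>, so this is a shrinking.\<close>
  define t where "t = root CARD('n) (1 / det A)"
  have t: "0 < t" "t \<le> 1" "t ^ CARD('n) * det A = 1" using A(2) by (simp_all add: t_def)
  define A' where "A' = t *\<^sub>R A"
  have A': "A' \<in> pos_def_matrices" "det A' = 1"
    using A t by (simp_all add: A'_def pos_def_matrices_scaleR det_scaleR)
  have "affine_copy (b - A' *v k) A' K \<subseteq> F v" if v: "v \<in> \<tau>" for v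
  proof -
    have vV: "v \<in> V" using v \<tau> by (auto simp: T_def)
    have "(b, A') \<in> C v"
      using bA[OF v] X(1)[OF vV] k t unfolding C_def A'_def by (intro copies_in_shrink) auto
    then have "affine_copy (b - A' *v k) A' K \<subseteq> X v"
      by (auto simp: affine_copy_def C_def copies_in_def matrix_vector_mult_diff_distrib diff_add_eq add_diff_eq)
    moreover have "invertible A'" using A'(2) by (simp add: invertible_det_nz)
    ultimately have "affine_copy (b - A' *v k) A' K \<subseteq> interior (X v)"
      using affine_copy_subset_interior assms(2) by blast
    \<comment> \<open>An open convex set is the interior of its closure.\<close>
    also have "\<dots> = F v"
      using assms(4)[OF vV] by (simp add: X_def convex_interior_closure interior_open)
    finally show ?thesis .
  qed
  moreover have "real (matroid_rank M (V - \<tau>)) \<le> real CARD('n) * (real CARD('n) + 3) / 2 - 1"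
  proof -
    have "matroid_rank M (V - \<tau>) + 1 \<le> CARD('n) * (CARD('n) + 3) div 2"
      using \<tau> by (simp add: T_def)
    then have "2 * (matroid_rank M (V - \<tau>) + 1) \<le> CARD('n) * (CARD('n) + 3)"
      by (simp only: less_eq_div_iff_mult_less_eq[OF zero_less_numeral] mult.commute[of 2])
    then have "real (2 * (matroid_rank M (V - \<tau>) + 1)) \<le> real (CARD('n) * (CARD('n) + 3))"
      by (rule of_nat_mono)
    then show ?thesis by simp
  qed
  ultimately show ?thesis using A' \<tau> by (intro exI[of _ \<tau>]) (auto simp: T_def)
qed

end
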